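(* For all integers $n\ge p\ge 2$, the number of $\alpha\in\mathcal{ODP}_n$ with $h(\alpha)=p$ is $$\frac{2n-p+1}{p+1}\binom{n}{p}.$$
   Context: Let $X_n=\{1,2,\dots,n\}$ and let $\mathcal{I}_n$ be the set of all partial injective maps of $X_n$ (including the empty map). $\mathcal{ODP}_n$ is the set of all $\alpha\in\mathcal{I}_n$ such that for all $x,y\in\mathrm{Dom}\,\alpha$, $|x-y|=|x\alpha-y\alpha|$, and $x\le y$ implies $x\alpha\le y\alpha$ (order-preserving partial isometries; $x\alpha$ denotes the image of $x$ under $\alpha$). The height of $\alpha$ is $h(\alpha)=|\mathrm{Im}\,\alpha|$. *)

theory Defs
  imports Complex_Main
begin

definition Xn :: "nat \<Rightarrow> nat set" where
  "Xn n = {1..n}"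

definition partial_injections :: "nat \<Rightarrow> (nat \<rightharpoonup> nat) set" where
  "partial_injections n = {\<alpha>. dom \<alpha> \<subseteq> Xn n \<and> ran \<alpha> \<subseteq> Xn n \<and> inj_on \<alpha> (dom \<alpha>)}"

definition ODP :: "nat \<Rightarrow> (nat \<rightharpoonup> nat) set" where
  "ODP n = {\<alpha> \<in> partial_injections n.
     \<forall>x \<in> dom \<alpha>. \<forall>y \<in> dom \<alpha>.
       \<bar>int x - int y\<bar> = \<bar>int (the (\<alpha> x)) - int (the (\<alpha> y))\<bar> \<and>
       (x \<le> y \<longrightarrow> the (\<alpha> x) \<le> the (\<alpha> y))}"

definition height :: "(nat \<rightharpoonup> nat) \<Rightarrow> nat" where
  "height \<alpha> = card (ran \<alpha>)"

end

theory Submission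
  imports Defs
begin

text \<open>An order-preserving partial isometry with nonempty domain is the restriction of a translation
  by some integer \<open>d\<close>, where the domain is any nonempty subset of the \<open>n - \<bar>d\<bar>\<close> points that the
  translation keeps inside \<open>{1..n}\<close>. Hence there are
  \<open>\<Sum>\<bar>d\<bar>\<le>n. (n - \<bar>d\<bar> choose p) = 2 * (n + 1 choose p + 1) - (n choose p)\<close> of them of height \<open>p > 0\<close>.\<close>

text \<open>The shift may be negative, so the sum is formed in \<open>int\<close>. Truncation by
  \<open>nat\<close> never occurs when \<open>A\<close> lies in
  \<open>translatable n d\<close>.\<close>

definition translation_on :: "int \<Rightarrow> nat set \<Rightarrow> nat \<rightharpoonup> nat" where
  "translation_on d A = (\<lambda>x. if x \<in> A then Some (nat (int x + d)) else None)"

definition translatable :: "nat \<Rightarrow> int \<Rightarrow> nat set" where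
  "translatable n d = {x \<in> {1..n}. 1 \<le> int x + d \<and> int x + d \<le> int n}"

lemma dom_translation_on [simp]: "dom (translation_on d A) = A"
  by (auto simp: translation_on_def dom_def)

lemma finite_translatable [simp]: "finite (translatable n d)"
  by (simp add: translatable_def)

lemma card_translatable: "card (translatable n d) = n - nat \<bar>d\<bar>"
proof -
  \<comment> \<open>At most one of \<open>nat (- d)\<close> and \<open>nat d\<close> is nonzero: a
    shift cuts off one end only. For \<bar>d\<bar> \<ge> n the interval is empty, matching truncated
    subtraction.\<close>
  have "translatable n d = {1 + nat (- d)..n - nat d}"
    by (auto simp: translatable_def)
  then show ?thesis
    by simp
qed

text \<open>Lets the height be read off the domain, so that fixing the height means fixing the size
  of the translated set.\<close>

lemma card_ran_eq_card_dom:
  assumes "inj_on \<alpha> (dom \<alpha>)"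
  shows "card (ran \<alpha>) = card (dom \<alpha>)"
proof -
  have "inj_on (the \<circ> \<alpha>) (dom \<alpha>)"
  proof (rule inj_onI)
    fix x y
    assume xy: "x \<in> dom \<alpha>" "y \<in> dom \<alpha>" and "(the \<circ> \<alpha>) x = (the \<circ> \<alpha>) y"
    then have "\<alpha> x = \<alpha> y"
      by auto
    with assms xy show "x = y"
      by (simp add: inj_on_eq_iff)
  qed
  moreover have "ran \<alpha> = (the \<circ> \<alpha>) ` dom \<alpha>"
    by (auto simp: ran_def intro: rev_image_eqI)
  ultimately show ?thesis
    by (simp only: card_image)
qed

lemma translation_on_in_ODP:
  assumes "A \<subseteq> translatable n d"
  shows "translation_on d A \<in> ODP n"
proof -
  have bounds: "1 \<le> x \<and> x \<le> n \<and> 1 \<le> int x + d \<and> int x + d \<le> int n" if "x \<in> A" for x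
    using that assms by (auto simp: translatable_def)
  have "inj_on (translation_on d A) A"
    by (rule inj_onI) (use bounds in \<open>fastforce simp: translation_on_def\<close>)
  moreover have "ran (translation_on d A) \<subseteq> Xn n"
    using bounds by (fastforce simp: translation_on_def ran_def Xn_def split: if_splits)
  moreover have "A \<subseteq> Xn n"
    using bounds by (auto simp: Xn_def)
  ultimately have inj: "translation_on d A \<in> partial_injections n"
    by (simp add: partial_injections_def)
  \<comment> \<open>Once positivity removes \<open>nat\<close>, both defining conditions become
    linear arithmetic.\<close>
  have shift: "int (the (translation_on d A x)) = int x + d" if "x \<in> A" for x
    using bounds[OF that] that by (simp add: translation_on_def)
  have "\<bar>int x - int y\<bar> =
        \<bar>int (the (translation_on d A x)) - int (the (translation_on d A y))\<bar> \<and>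
      (x \<le> y \<longrightarrow> the (translation_on d A x) \<le> the (translation_on d A y))"
    if "x \<in> A" "y \<in> A" for x y
    using shift[OF that(1)] shift[OF that(2)] by linarith
  with inj show ?thesis
    unfolding ODP_def dom_translation_on mem_Collect_eq by blast
qed

text \<open>Take \<open>d\<close> to be the displacement of one domain point \<open>m\<close>. The
  isometry condition leaves two candidates for the image of any other point, placed symmetrically
  about the image of \<open>m\<close>; order preservation selects the translate.\<close>

lemma ODP_eq_translation_on:
  assumes "\<alpha> \<in> ODP n" and "dom \<alpha> \<noteq> {}"
  obtains d where "\<bar>d\<bar> \<le> int n" and "dom \<alpha> \<subseteq> translatable n d" and "\<alpha> = translation_on d (dom \<alpha>)"
proof -
  obtain m where m: "m \<in> dom \<alpha>"
    using assms(2) by blast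
  define d where "d = int (the (\<alpha> m)) - int m"
  have bounds: "1 \<le> x \<and> x \<le> n \<and> 1 \<le> the (\<alpha> x) \<and> the (\<alpha> x) \<le> n" if "x \<in> dom \<alpha>" for x
  proof -
    have "the (\<alpha> x) \<in> ran \<alpha>"
      using that by (auto simp: ran_def)
    then show ?thesis
      using that assms(1) by (force simp: ODP_def partial_injections_def Xn_def)
  qed
  have shift: "int (the (\<alpha> x)) = int x + d" if x: "x \<in> dom \<alpha>" for x
  proof -
    have "\<bar>int x - int m\<bar> = \<bar>int (the (\<alpha> x)) - int (the (\<alpha> m))\<bar>"
      and "x \<le> m \<longrightarrow> the (\<alpha> x) \<le> the (\<alpha> m)" and "m \<le> x \<longrightarrow> the (\<alpha> m) \<le> the (\<alpha> x)"
      using assms(1) x m unfolding ODP_def by blast+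
    then show ?thesis
      unfolding d_def by linarith
  qed
  show thesis
  proof
    show "\<bar>d\<bar> \<le> int n"
      using bounds[OF m] unfolding d_def by linarith
    show "dom \<alpha> \<subseteq> translatable n d"
    proof
      fix x assume x: "x \<in> dom \<alpha>"
      show "x \<in> translatable n d"
        using bounds[OF x] shift[OF x] by (auto simp: translatable_def)
    qed
    show "\<alpha> = translation_on d (dom \<alpha>)"
    proof
      fix x
      show "\<alpha> x = translation_on d (dom \<alpha>) x"
        using shift[of x] by (cases "\<alpha> x") (auto simp: translation_on_def dom_def)
    qed
  qed
qed

text \<open>A single point of \<open>A\<close> determines the shift. Nonemptiness matters: the empty
  map is a translation by every \<open>d\<close>.\<close>

lemma translation_on_inject:
  assumes "translation_on d A = translation_on e B"
    and "A \<subseteq> translatable n d" and "B \<subseteq> translatable n e" and "A \<noteq> {}"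
  shows "d = e \<and> A = B"
proof -
  have AB: "A = B"
    using assms(1) dom_translation_on by metis
  obtain x where x: "x \<in> A"
    using assms(4) by blast
  have "nat (int x + d) = nat (int x + e)"
    using fun_cong[OF assms(1), of x] x AB by (simp add: translation_on_def)
  \<comment> \<open>Positivity allows \<open>nat\<close> to be cancelled.\<close>
  moreover have "1 \<le> int x + d" "1 \<le> int x + e"
    using x AB assms(2,3) by (auto simp: translatable_def)
  ultimately show ?thesis
    using AB by linarith
qed

lemma card_ODP_height:
  assumes "0 < p"
  shows "card {\<alpha> \<in> ODP n. height \<alpha> = p} = (\<Sum>d\<in>{- int n..int n}. (n - nat \<bar>d\<bar>) choose p)"
proof -
  \<comment> \<open>Pairs of a shift and a domain; \<open>translation_on\<close> maps them
    bijectively to the maps being counted, since 0 < p makes every such domain nonempty.\<close>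
  define S where
    "S = (SIGMA d:{- int n..int n}. {A. A \<subseteq> translatable n d \<and> card A = p})"
  have height_eq: "height \<alpha> = card (dom \<alpha>)" if "\<alpha> \<in> ODP n" for \<alpha>
    using that by (simp add: height_def ODP_def partial_injections_def card_ran_eq_card_dom)
  have "inj_on (\<lambda>(d, A). translation_on d A) S"
  proof (rule inj_onI, clarify)
    fix d A e B
    assume "(d, A) \<in> S" "(e, B) \<in> S" and eq: "translation_on d A = translation_on e B"
    then have "A \<subseteq> translatable n d" "B \<subseteq> translatable n e" "A \<noteq> {}"
      using assms by (auto simp: S_def)
    from translation_on_inject[OF eq this] show "d = e \<and> A = B" .
  qed
  moreover have "(\<lambda>(d, A). translation_on d A) ` S = {\<alpha> \<in> ODP n. height \<alpha> = p}"
  proof (intro equalityI subsetI)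
    fix \<alpha> assume "\<alpha> \<in> (\<lambda>(d, A). translation_on d A) ` S"
    then show "\<alpha> \<in> {\<alpha> \<in> ODP n. height \<alpha> = p}"
      by (auto simp: S_def translation_on_in_ODP height_eq)
  next
    fix \<alpha> assume "\<alpha> \<in> {\<alpha> \<in> ODP n. height \<alpha> = p}"
    then have \<alpha>: "\<alpha> \<in> ODP n" and card: "card (dom \<alpha>) = p"
      using height_eq by auto
    have "dom \<alpha> \<noteq> {}"
      using card assms by (metis card.empty less_irrefl)
    from ODP_eq_translation_on[OF \<alpha> this] obtain d where "\<bar>d\<bar> \<le> int n"
      and "dom \<alpha> \<subseteq> translatable n d" and eq: "\<alpha> = translation_on d (dom \<alpha>)" .
    then have "(d, dom \<alpha>) \<in> S"
      using card by (simp add: S_def abs_le_iff)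
    with eq show "\<alpha> \<in> (\<lambda>(d, A). translation_on d A) ` S"
      by (auto intro: rev_image_eqI)
  qed
  ultimately have "card {\<alpha> \<in> ODP n. height \<alpha> = p} = card S"
    by (metis card_image)
  also have "\<dots> = (\<Sum>d\<in>{- int n..int n}. card {A. A \<subseteq> translatable n d \<and> card A = p})"
    unfolding S_def by (rule card_SigmaI) auto
  also have "\<dots> = (\<Sum>d\<in>{- int n..int n}. (n - nat \<bar>d\<bar>) choose p)"
    by (simp add: n_subsets card_translatable)
  finally show ?thesis .
qed

text \<open>The summand is even in \<open>d\<close>, so the halves d \<le> 0 and d \<ge> 0 have
  equal sums and share only d = 0. That term, \<open>n choose p\<close>, is added on the left to
  avoid subtraction in \<open>nat\<close>.\<close>

lemma sum_choose_symmetric: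
  "(\<Sum>d\<in>{- int n..int n}. (n - nat \<bar>d\<bar>) choose p) + (n choose p) = 2 * (Suc n choose Suc p)"
proof -
  define f where "f d = (n - nat \<bar>d\<bar>) choose p" for d :: int
  have nonneg: "sum f {0..int n} = (Suc n choose Suc p)"
  proof -
    \<comment> \<open>Substituting k = n - d prepares the hockey-stick identity.\<close>
    have "sum f {0..int n} = (\<Sum>k\<le>n. k choose p)"
      by (rule sum.reindex_bij_witness[of _ "\<lambda>k. int (n - k)" "\<lambda>d. n - nat d"])
        (auto simp: f_def)
    then show ?thesis
      by (simp only: sum_choose_upper)
  qed
  have neg: "sum f {- int n..0} = sum f {0..int n}"
    by (rule sum.reindex_bij_witness[of _ uminus uminus]) (auto simp: f_def)
  have split: "{- int n..int n} = {- int n..0} \<union> {0..int n}" "{- int n..0} \<inter> {0..int n} = {0}"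
    by auto
  have "sum f {- int n..int n} + sum f {0} = sum f {- int n..0} + sum f {0..int n}"
    using sum.union_inter[of "{- int n..0}" "{0..int n}" f] unfolding split by simp
  then show ?thesis
    using neg nonneg by (simp add: f_def)
qed

theorem proposition3p4:
  fixes n p :: nat
  assumes "2 \<le> p" and "p \<le> n"
  shows "real (card {\<alpha> \<in> ODP n. height \<alpha> = p})
           = (2 * real n - real p + 1) / (real p + 1) * real (n choose p)"
proof -
  have "card {\<alpha> \<in> ODP n. height \<alpha> = p} + (n choose p) = 2 * (Suc n choose Suc p)"
    using card_ODP_height[of p n] sum_choose_symmetric[of n p] assms(1) by simp
  then have "real (card {\<alpha> \<in> ODP n. height \<alpha> = p}) =
      2 * real (Suc n choose Suc p) - real (n choose p)"
    by linarith
  \<comment> \<open>Absorption expresses everything through \<open>n choose p\<close>, with factor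
    2(n + 1)/(p + 1) - 1 = (2n - p + 1)/(p + 1).\<close>
  moreover have "(real p + 1) * real (Suc n choose Suc p) = (real n + 1) * real (n choose p)"
    using arg_cong[OF Suc_times_binomial[of p n], of real] by (simp add: algebra_simps)
  then have "real (Suc n choose Suc p) = (real n + 1) * real (n choose p) / (real p + 1)"
    by (simp add: field_simps)
  ultimately show ?thesis
    by (simp add: field_simps)
qed

end
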